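(* Let $f:\mathbb{R}^d\to\mathbb{R}$ be $C^1$ with $\nabla f$ Lipschitz continuous on $\mathbb{R}^d$ with constant $L>0$, bounded from below, with set of minimizers $\mathcal M=\{x: f(x)=\inf f\}$, and let $\mu>0$. Assume that the closest point projection onto $\mathcal M$ is an affine linear map $\pi(x)=Px+x^*$ as described in the context, that $$\langle\nabla f(x),x-\pi(x)\rangle\ge f(x)-f(\pi(x))+\frac{\mu}{2}\|x-\pi(x)\|^2\qquad\text{for all }x\in\mathbb{R}^d,$$ and that for some $\varepsilon$ $$\langle\nabla f(x+v),v\rangle\ge f(x+v)-f(x)-\frac{\varepsilon}{2}\|v\|^2\qquad\text{for all }x,v\in\mathbb{R}^d.$$ Let $(\Omega,\mathcal A,\mathbb Q)$ be a probability space and $g:\mathbb{R}^d\times\Omega\to\mathbb{R}^d$ a measurable function such that for some $\sigma_a,\sigma_m\ge 0$ and all $x\in\mathbb{R}^d$ $$\mathbb{E}_{\omega\sim\mathbb Q}[g(x,\omega)]=\nabla f(x),\quad \mathbb{E}_{\omega\sim\mathbb Q}[\|g(x,\omega)\|^2]<\infty,\quad \mathbb{E}_{\omega\sim\mathbb Q}[\|g(x,\omega)-\nabla f(x)\|^2]\le\sigma_a^2+\sigma_m^2\|\nabla f(x)\|^2.$$ Let $$0<\eta\le\frac{1}{L(1+\sigma_m^2)},\qquad \rho=\frac{1-\sqrt{\frac{\mu\eta}{1+\sigma_m^2}}}{1+\sqrt{\frac{\mu\eta}{1+\sigma_m^2}}},\qquad \alpha=\frac{1-\sqrt{\mu(1+\sigma_m^2)\eta}}{1-\sqrt{\mu(1+\sigma_m^2)\eta}+\sigma_m^2}\,\eta.$$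 Let $x_0$ be a (possibly random) initial condition in $\mathbb{R}^d$, $v_0=0$, let $\omega_0,\omega_1,\dots$ be drawn with law $\mathbb Q$ independently of each other and of $x_0$, and let $x_n,x_n',v_n$ be generated by the AGNES scheme $$x_n'=x_n+\sqrt{\alpha}\,v_n,\qquad g_n=g(x_n',\omega_n),\qquad x_{n+1}=x_n'-\eta g_n,\qquad v_{n+1}=\rho\,(v_n-\sqrt{\alpha}\,g_n).$$ Then, if $\varepsilon<\sqrt{\mu(1+\sigma_m^2)/\eta}$, for all $n\ge 0$ $$\mathbb{E}[f(x_n)-\inf f]\le\left(1-\sqrt{\frac{\mu\eta}{1+\sigma_m^2}}\right)^n\mathbb{E}\left[f(x_0)-\inf f+\frac{\mu}{2}\|x_0-\pi(x_0)\|^2\right]+\frac{\sigma_a^2\sqrt{\eta}}{\sqrt{\mu(1+\sigma_m^2)}}.$$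
   Context: Affine projection: $V\subset\mathbb{R}^d$ is a linear subspace of dimension $k<d$, $P:\mathbb{R}^d\to\mathbb{R}^d$ is the orthogonal projection onto $V$, $x^*$ is the (unique) element of smallest Euclidean norm in the affine space $x^*+V$ (equivalently $x^*\perp V$), the set of minimizers $\mathcal M=\{x\in\mathbb{R}^d: f(x)=\inf_{z} f(z)\}$ is non-empty and equals $x^*+V$, and $\pi(x)=Px+x^*$ is the closest point projection onto $\mathcal M$. Unsubscripted expectations are over $x_0$ and all $\omega_i$. *)

theory Defs
  imports "HOL-Analysis.Analysis" "HOL-Probability.Probability"
begin

definition minimizers :: "('a \<Rightarrow> real) \<Rightarrow> 'a set" where
  "minimizers f = {x. f x = (INF z. f z)}"

definition orthogonal_projection_onto :: "'a::real_inner set \<Rightarrow> ('a \<Rightarrow> 'a) \<Rightarrow> bool" where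
  "orthogonal_projection_onto V P \<longleftrightarrow> (\<forall>x. P x \<in> V \<and> (\<forall>v\<in>V. orthogonal (x - P x) v))"

text \<open>
  The first argument is the stochastic gradient as a function of the evaluation point and the
  noise; the remaining function arguments are sequences indexed by the iteration. The scheme is
  stated for a single realization of the noise.
\<close>
definition agnes_scheme ::
  "('a::real_vector \<Rightarrow> 'w \<Rightarrow> 'a) \<Rightarrow> real \<Rightarrow> real \<Rightarrow> real \<Rightarrow>
   (nat \<Rightarrow> 'w) \<Rightarrow> (nat \<Rightarrow> 'a) \<Rightarrow> (nat \<Rightarrow> 'a) \<Rightarrow> (nat \<Rightarrow> 'a) \<Rightarrow> bool" where
  "agnes_scheme g \<eta> \<rho> \<alpha> \<omega> x x' v \<longleftrightarrow>
     v 0 = 0 \<and>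
     (\<forall>n. x' n = x n + sqrt \<alpha> *\<^sub>R v n \<and>
          x (Suc n) = x' n - \<eta> *\<^sub>R g (x' n) (\<omega> n) \<and>
          v (Suc n) = \<rho> *\<^sub>R (v n - sqrt \<alpha> *\<^sub>R g (x' n) (\<omega> n)))"

text \<open>
  Joint independence of one random variable and a sequence of random variables with values in a
  space of a different type, for which the library's notion for families does not apply.
  It is stated as there, by independence of the generated sigma-algebras.
\<close>
definition indep_initial_noise ::
  "'s measure \<Rightarrow> 'a measure \<Rightarrow> ('s \<Rightarrow> 'a) \<Rightarrow> 'w measure \<Rightarrow> (nat \<Rightarrow> 's \<Rightarrow> 'w) \<Rightarrow> bool" where
  "indep_initial_noise N A X Q \<omega> \<longleftrightarrow>
     X \<in> measurable N A \<and> (\<forall>i. \<omega> i \<in> measurable N Q) \<and>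
     prob_space.indep_sets N
       (case_option {X -` B \<inter> space N | B. B \<in> sets A}
                    (\<lambda>i. {\<omega> i -` B \<inter> space N | B. B \<in> sets Q})) UNIV"

end

theory Submission
  imports Defs
begin

text \<open>
  The proof is a Lyapunov argument. Put \<open>c = 1 + \<sigma>\<^sub>m\<^sup>2\<close>, \<open>q = sqrt (\<mu> \<eta> / c)\<close> and write
  \<open>offset y = y - \<pi> y\<close>, a vector orthogonal to \<open>V\<close>. Split the velocity into its part \<open>P v\<close> along the
  manifold of minimizers and its part \<open>v - P v\<close> transversal to it, and consider
  \<open>energy x v = f x - inf f + |b (v - P v) + sqrt \<mu> offset (x + sqrt \<alpha> v)|\<^sup>2 / 2 + K |P v|\<^sup>2 / 2\<close>
  with suitable weights \<open>b\<close> and \<open>K\<close>. One step of the scheme satisfies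
  \<open>E[energy (x', v')] \<le> (1 - q) energy x v + \<eta> \<sigma>\<^sub>a\<^sup>2 / c\<close>; iterating this and summing the
  geometric series for the noise gives the claim, because \<open>v\<^sub>0 = 0\<close> makes the initial energy
  \<open>f x - inf f + \<mu> |x - \<pi> x|\<^sup>2 / 2\<close>.

  The decay has the following reason. The parameters are tuned so that the transversal vector in the
  energy is mapped to \<open>(1 - q) b (v - P v) + sqrt \<mu> offset y - sqrt (\<eta> / c) (g - P g)\<close>, where
  \<open>y = x + sqrt \<alpha> v\<close> and \<open>g\<close> is the stochastic gradient at \<open>y\<close>. Expanding the squares and
  bounding \<open>f\<close> by the descent lemma gives a term linear in \<open>g\<close>, in which \<open>g\<close>
  becomes the gradient on taking expectations, and a quadratic one. The quadratic term is at most \<open>(\<eta> / c) |g|\<^sup>2\<close> and costs, in expectation,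
  \<open>(\<eta> / c) (\<sigma>\<^sub>a\<^sup>2 + c |grad y|\<^sup>2)\<close>; its gradient part is paid for by the decrease of \<open>f\<close> along
  the gradient step. In the linear term, the gradient is paired with \<open>q offset y\<close>, where strong
  convexity with respect to the closest minimizer applies, and with \<open>(1 - q) sqrt \<alpha> v\<close>, where almost
  convexity applies. This is the point of the weight \<open>K\<close>: with it the transversal and the tangential
  contributions have the same coefficient, so that the full velocity appears, as almost convexity
  demands. The remaining error \<open>(1 - q) \<epsilon> \<alpha> |v|\<^sup>2 / 2\<close> is absorbed by the loss of kinetic energy
  when \<open>\<epsilon> \<le> sqrt (\<mu> c / \<eta>)\<close>. The expansion is lemma
  \<open>energy_step_le\<close>, the use of the two convexity conditions is lemma \<open>energy_contraction\<close>.

  Two more ingredients are needed. Strong convexity with respect to the closest minimizer forces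
  \<open>\<mu> \<le> L\<close> (lemma \<open>mu_le_L\<close>), hence, by the bound on \<open>\<eta>\<close>, \<open>c q \<le> 1\<close>, so that \<open>sqrt \<alpha>\<close>
  and \<open>b\<close> are square roots of nonnegative numbers. And the one-step bound for a deterministic state passes to the random state \<open>(x\<^sub>n, v\<^sub>n)\<close> because this state is a function of
  \<open>x\<^sub>0, \<omega>\<^sub>0, \<dots>, \<omega>\<^sub>n\<^sub>-\<^sub>1\<close>, hence independent of \<open>\<omega>\<^sub>n\<close> (lemma \<open>nn_integral_fresh_noise\<close>). All
  expectations are integrals of nonnegative functions, so an infinite initial energy is covered.
\<close>

section \<open>Functions with Lipschitz gradient\<close>

lemma GDERIV_along_line:
  fixes f :: "'a::real_inner \<Rightarrow> real"
  assumes "\<And>y. GDERIV f y :> grad y"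
  shows "((\<lambda>t. f (y + t *\<^sub>R u)) has_real_derivative (grad (y + t *\<^sub>R u) \<bullet> u)) (at t)"
proof -
  have "((\<lambda>t. f (y + t *\<^sub>R u)) has_derivative (\<lambda>h. (h *\<^sub>R u) \<bullet> grad (y + t *\<^sub>R u))) (at t)"
    using assms[of "y + t *\<^sub>R u", unfolded gderiv_def]
    by (rule has_derivative_compose[rotated]) (auto intro!: derivative_eq_intros)
  then show ?thesis
    by (simp add: has_field_derivative_def inner_commute mult.commute[of _ "_ \<bullet> _"])
qed

text \<open>
  By the Lipschitz bound, the derivative along the segment exceeds its initial value by at most
  \<open>L t |u|\<^sup>2\<close>, so the difference of the two sides is monotone along the segment.
\<close>
lemma descent_lemma:
  fixes f :: "'a::real_inner \<Rightarrow> real"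
  assumes grad: "\<And>y. GDERIV f y :> grad y" and lip: "L-lipschitz_on UNIV grad"
  shows "f (y + u) \<le> f y + grad y \<bullet> u + L / 2 * (norm u)\<^sup>2"
proof -
  define h where "h = (\<lambda>t::real. f (y + t *\<^sub>R u) - t * (grad y \<bullet> u) - L / 2 * t\<^sup>2 * (norm u)\<^sup>2)"
  have "h 1 \<le> h 0"
  proof (rule DERIV_nonpos_imp_nonincreasing[where f = h])
    fix t :: real assume t: "0 \<le> t" "t \<le> 1"
    have "(grad (y + t *\<^sub>R u) - grad y) \<bullet> u \<le> norm (grad (y + t *\<^sub>R u) - grad y) * norm u"
      by (rule norm_cauchy_schwarz)
    also have "\<dots> \<le> (L * norm (t *\<^sub>R u)) * norm u"
      using lipschitz_onD[OF lip, of "y + t *\<^sub>R u" y]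
      by (intro mult_right_mono) (auto simp: dist_norm)
    finally have "grad (y + t *\<^sub>R u) \<bullet> u - grad y \<bullet> u - L * t * (norm u)\<^sup>2 \<le> 0"
      using t by (simp add: inner_diff_left power2_eq_square)
    moreover have "(h has_real_derivative
        (grad (y + t *\<^sub>R u) \<bullet> u - grad y \<bullet> u - L * t * (norm u)\<^sup>2)) (at t)"
      unfolding h_def
      by (rule derivative_eq_intros GDERIV_along_line[OF grad] refl | simp)+
    ultimately show "\<exists>d. (h has_real_derivative d) (at t) \<and> d \<le> 0" by blast
  qed simp
  then show ?thesis by (simp add: h_def)
qed

text \<open>
  A gradient step of length \<open>1 / L\<close> would decrease \<open>f\<close> by \<open>|grad y|\<^sup>2 / (2 L)\<close>.
\<close>
lemma gradient_zero_at_minimizer: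
  fixes f :: "'a::real_inner \<Rightarrow> real"
  assumes grad: "\<And>y. GDERIV f y :> grad y" and lip: "L-lipschitz_on UNIV grad" and L: "L > 0"
    and min: "\<And>z. f y \<le> f z"
  shows "grad y = 0"
proof -
  have "f y \<le> f (y + (- 1 / L) *\<^sub>R grad y)" by (rule min)
  also have "\<dots> \<le> f y + grad y \<bullet> ((- 1 / L) *\<^sub>R grad y) + L / 2 * (norm ((- 1 / L) *\<^sub>R grad y))\<^sup>2"
    by (rule descent_lemma[OF grad lip])
  also have "\<dots> = f y - (norm (grad y))\<^sup>2 / (2 * L)"
    using L by (simp add: power2_norm_eq_inner[symmetric] power_mult_distrib field_simps)
       (simp add: power2_eq_square)
  finally show ?thesis using L by (simp add: field_simps)
qed

text \<open>
  The hypothesis \<open>ray\<close> says that \<open>\<phi> t / t - \<kappa> t\<close> is nondecreasing for \<open>t > 0\<close>. Nonnegativity of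
  \<open>\<phi>\<close> bounds it below by \<open>- \<kappa> t\<close>, which tends to \<open>0\<close> as \<open>t\<close> does, so it is nonnegative at \<open>1\<close>.
  A single small time \<open>s\<close> with \<open>\<kappa> s \<le> e\<close> replaces the limit.
\<close>
lemma quadratic_growth_of_ray_inequality:
  fixes \<phi> \<phi>' :: "real \<Rightarrow> real"
  assumes deriv: "\<And>t. (\<phi> has_real_derivative \<phi>' t) (at t)"
    and nonneg: "\<And>t. 0 \<le> \<phi> t"
    and ray: "\<And>t. 0 < t \<Longrightarrow> \<phi> t + \<kappa> * t\<^sup>2 \<le> t * \<phi>' t"
    and kappa: "0 \<le> \<kappa>"
  shows "\<kappa> \<le> \<phi> 1"
proof (rule field_le_epsilon)
  fix e :: real assume e: "e > 0"
  define h where "h = (\<lambda>t. \<phi> t / t - \<kappa> * t)"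
  define s where "s = e / (e + \<kappa>)"
  have s: "0 < s" "s \<le> 1" "\<kappa> * s \<le> e"
    using e kappa by (auto simp: s_def field_simps)
  have "h s \<le> h 1"
  proof (rule DERIV_nonneg_imp_nondecreasing[where f = h])
    fix t assume "s \<le> t" "t \<le> 1"
    with s have t: "0 < t" by simp
    have "(h has_real_derivative ((\<phi>' t * t - \<phi> t) / (t * t) - \<kappa>)) (at t)"
      unfolding h_def using t by (auto intro!: derivative_eq_intros deriv)
    moreover have "0 \<le> (\<phi>' t * t - \<phi> t) / (t * t) - \<kappa>"
      using ray[OF t] t by (simp add: field_simps power2_eq_square)
    ultimately show "\<exists>d. (h has_real_derivative d) (at t) \<and> 0 \<le> d" by blast
  qed (use s in auto)
  moreover have "- \<kappa> * s \<le> h s" using nonneg[of s] s by (simp add: h_def)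
  ultimately show "\<kappa> \<le> \<phi> 1 + e" using s by (simp add: h_def)
qed

section \<open>Affine sets of minimizers\<close>

lemma norm_scaled_sum_square:
  fixes a b :: "'a::real_inner"
  shows "(norm (r *\<^sub>R a + s *\<^sub>R b))\<^sup>2 = r\<^sup>2 * (norm a)\<^sup>2 + 2 * (r * s * (a \<bullet> b)) + s\<^sup>2 * (norm b)\<^sup>2"
  unfolding power2_norm_eq_inner
  by (simp add: inner_add_left inner_add_right inner_commute[of b a] power2_eq_square algebra_simps)

locale affine_minimizers =
  fixes f :: "'a::real_inner \<Rightarrow> real" and grad :: "'a \<Rightarrow> 'a"
    and V :: "'a set" and P :: "'a \<Rightarrow> 'a" and xstar :: 'a and L \<mu> :: real
  assumes gradient: "\<And>y. GDERIV f y :> grad y"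
    and L_pos: "L > 0"
    and lipschitz: "L-lipschitz_on UNIV grad"
    and bounded_below: "bdd_below (range f)"
    and mu_pos: "\<mu> > 0"
    and V_subspace: "subspace V"
    and P_proj: "orthogonal_projection_onto V P"
    and minimizers_affine: "minimizers f = {xstar + u | u. u \<in> V}"
    and xstar_min_norm: "\<And>u. u \<in> V \<Longrightarrow> norm xstar \<le> norm (xstar + u)"
    and strong_convexity_min:
      "\<And>y. grad y \<bullet> (y - (P y + xstar))
        \<ge> f y - f (P y + xstar) + \<mu> / 2 * (norm (y - (P y + xstar)))\<^sup>2"
begin

lemma P_in_V: "P x \<in> V"
  using P_proj by (simp add: orthogonal_projection_onto_def)

lemma inner_residual_V: "u \<in> V \<Longrightarrow> (x - P x) \<bullet> u = 0"
  using P_proj by (simp add: orthogonal_projection_onto_def orthogonal_def)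

lemma P_eqI:
  assumes p: "p \<in> V" and orth: "\<And>u. u \<in> V \<Longrightarrow> (x - p) \<bullet> u = 0"
  shows "P x = p"
proof -
  have d: "P x - p \<in> V" using V_subspace P_in_V p by (rule subspace_diff)
  have "(P x - p) \<bullet> (P x - p) = (x - p) \<bullet> (P x - p) - (x - P x) \<bullet> (P x - p)"
    by (simp add: inner_diff_left)
  also have "\<dots> = 0" using d orth inner_residual_V by simp
  finally show ?thesis by simp
qed

lemma P_linear: "linear P"
proof (rule linearI)
  fix x y :: 'a and r :: real
  show "P (x + y) = P x + P y"
    using inner_residual_V[of _ x] inner_residual_V[of _ y]
    by (intro P_eqI subspace_add V_subspace P_in_V)
       (auto simp: inner_diff_left inner_add_left)
  show "P (r *\<^sub>R x) = r *\<^sub>R P x"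
    using inner_residual_V[of _ x]
    by (intro P_eqI subspace_scale V_subspace P_in_V) (auto simp: inner_diff_left)
qed

lemmas P_simps = linear_add[OF P_linear] linear_diff[OF P_linear] linear_scale[OF P_linear]

lemma P_of_V: "u \<in> V \<Longrightarrow> P u = u"
  by (rule P_eqI) auto

definition gap :: "'a \<Rightarrow> real" where "gap x = f x - (INF z. f z)"

definition offset :: "'a \<Rightarrow> 'a" where "offset x = x - (P x + xstar)"

text \<open>
  Otherwise removing its component along \<open>V\<close> would make \<open>xstar\<close> shorter.
\<close>
lemma P_xstar: "P xstar = 0"
proof -
  have "norm xstar \<le> norm (xstar - P xstar)"
    using xstar_min_norm[of "- P xstar"] P_in_V V_subspace by (simp add: subspace_neg)
  then have "xstar \<bullet> xstar \<le> (xstar - P xstar) \<bullet> (xstar - P xstar)"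
    by (simp add: norm_le)
  moreover have "(xstar - P xstar) \<bullet> P xstar = 0" by (rule inner_residual_V[OF P_in_V])
  ultimately have "P xstar \<bullet> P xstar \<le> 0"
    by (simp add: inner_diff_left inner_diff_right inner_commute)
  then show ?thesis by (metis antisym inner_eq_zero_iff inner_ge_zero)
qed

lemma xstar_orthogonal: "xstar \<bullet> P u = 0"
  using inner_residual_V[OF P_in_V, of xstar u] P_xstar by simp

lemma offset_orthogonal: "offset x \<bullet> P u = 0"
  using inner_residual_V[OF P_in_V, of x u] xstar_orthogonal[of u]
  by (simp add: offset_def inner_diff_left inner_add_left)

lemma P_offset: "P (offset x) = 0"
  by (simp add: offset_def P_simps P_of_V[OF P_in_V] P_xstar)

lemma offset_add: "offset (x + h) = offset x + (h - P h)"
  by (simp add: offset_def P_simps)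

lemma gap_nonneg: "0 \<le> gap x"
  using bounded_below by (simp add: gap_def cINF_lower)

lemma gap_closest: "gap (P x + xstar) = 0"
proof -
  have "P x + xstar \<in> minimizers f"
    unfolding minimizers_affine using P_in_V[of x] by (auto simp: add.commute)
  then show ?thesis by (simp add: gap_def minimizers_def)
qed

lemma strong_convexity_gap: "gap y + \<mu> / 2 * (norm (offset y))\<^sup>2 \<le> grad y \<bullet> offset y"
  using strong_convexity_min[of y] gap_closest[of y] by (simp add: gap_def offset_def)

text \<open>
  All points of the ray from the closest minimizer \<open>p\<close> through \<open>x\<close> have the closest minimizer \<open>p\<close>,
  so on this ray the strong convexity condition becomes a differential inequality for \<open>gap\<close>.
\<close>
lemma quadratic_growth: "\<mu> / 2 * (norm (offset x))\<^sup>2 \<le> gap x"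
proof -
  define p where "p = P x + xstar"
  define \<phi> where "\<phi> = (\<lambda>t. gap (p + t *\<^sub>R offset x))"
  have ex: "offset (p + t *\<^sub>R offset x) = t *\<^sub>R offset x" for t
    unfolding offset_add by (simp add: P_simps P_offset p_def)
       (simp add: offset_def P_simps P_of_V[OF P_in_V] P_xstar)
  have "\<mu> / 2 * (norm (offset x))\<^sup>2 \<le> \<phi> 1"
  proof (rule quadratic_growth_of_ray_inequality)
    fix t :: real
    show "(\<phi> has_real_derivative (grad (p + t *\<^sub>R offset x) \<bullet> offset x)) (at t)"
      unfolding \<phi>_def gap_def
      by (auto intro!: derivative_eq_intros GDERIV_along_line[OF gradient])
    show "\<phi> t + \<mu> / 2 * (norm (offset x))\<^sup>2 * t\<^sup>2 \<le> t * (grad (p + t *\<^sub>R offset x) \<bullet> offset x)"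
      using strong_convexity_gap[of "p + t *\<^sub>R offset x"] unfolding ex
      by (simp add: \<phi>_def power_mult_distrib mult.commute mult.left_commute)
  qed (use mu_pos gap_nonneg in \<open>auto simp: \<phi>_def\<close>)
  then show ?thesis by (simp add: \<phi>_def p_def offset_def)
qed

text \<open>
  At a point off the minimizers, quadratic growth and strong convexity together give
  \<open>grad y \<bullet> offset y \<ge> \<mu> |offset y|\<^sup>2\<close>, whereas the Lipschitz bound, compared with the vanishing
  gradient at the closest minimizer, limits it to \<open>L |offset y|\<^sup>2\<close>. Such a point exists as soon
  as \<open>V\<close> is not the whole space.
\<close>
lemma mu_le_L:
  assumes "V \<noteq> UNIV"
  shows "\<mu> \<le> L"
proof -
  obtain x where x: "x \<notin> V" using assms by blast
  have nz: "offset (x + xstar) \<noteq> 0"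
  proof
    assume "offset (x + xstar) = 0"
    then have "x = P x" by (simp add: offset_def P_simps P_xstar)
    then show False using P_in_V[of x] x by simp
  qed
  define y where "y = x + xstar"
  define p where "p = P y + xstar"
  have yp: "y - p = offset y" by (simp add: p_def offset_def)
  have "f p \<le> f z" for z
    using gap_closest[of y] gap_nonneg[of z] by (simp add: gap_def p_def)
  then have gp: "grad p = 0"
    by (rule gradient_zero_at_minimizer[OF gradient lipschitz L_pos])
  have "\<mu> * (norm (offset y))\<^sup>2 \<le> grad y \<bullet> offset y"
    using quadratic_growth[of y] strong_convexity_gap[of y] by simp
  also have "\<dots> \<le> norm (grad y - grad p) * norm (offset y)"
    unfolding gp by (simp add: norm_cauchy_schwarz)
  also have "\<dots> \<le> (L * norm (y - p)) * norm (offset y)"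
    using lipschitz_onD[OF lipschitz, of y p] by (intro mult_right_mono) (auto simp: dist_norm)
  finally have "\<mu> * (norm (offset y))\<^sup>2 \<le> L * (norm (offset y))\<^sup>2"
    by (simp add: yp power2_eq_square)
  then show ?thesis using nz by (simp add: y_def)
qed

lemma gap_measurable: "gap \<in> borel_measurable borel"
proof -
  have "continuous_on UNIV f"
    using gradient unfolding gderiv_def
    by (auto intro!: continuous_at_imp_continuous_on has_derivative_continuous)
  then show ?thesis unfolding gap_def by (intro borel_measurable_continuous_onI continuous_intros)
qed

end

section \<open>Pathwise estimates for the energy\<close>

text \<open>
  The step sizes of the scheme enter through square roots; the locale parametrizes them so that all
  relations are polynomial: \<open>\<mu> = m\<^sup>2\<close>, \<open>\<eta> = c k\<^sup>2\<close>, \<open>sqrt \<alpha> = b k\<close>, where \<open>c\<close> stands for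
  \<open>1 + \<sigma>\<^sub>m\<^sup>2\<close>. Then the decay rate \<open>sqrt (\<mu> \<eta> / c)\<close> is \<open>m k\<close>, the bound on \<open>\<eta>\<close> is \<open>step_le\<close>, and the
  bound \<open>\<epsilon> \<le> sqrt (\<mu> c / \<eta>)\<close> is \<open>eps\<close>. The relation \<open>b_eq\<close> determines \<open>b\<close> unless \<open>m k = 1\<close>.
\<close>
locale agnes_energy = affine_minimizers +
  fixes \<epsilon> m k c b :: real
  assumes almost_convexity:
      "\<And>y u. grad (y + u) \<bullet> u \<ge> f (y + u) - f y - \<epsilon> / 2 * (norm u)\<^sup>2"
    and m: "m > 0" "m\<^sup>2 = \<mu>" and k: "k > 0" and c: "1 \<le> c" and b: "0 \<le> b"
    and b_eq: "b\<^sup>2 * (1 - m * k) = 1 - c * (m * k)"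
    and q_le: "c * (m * k) \<le> 1"
    and step_le: "L * (c * k)\<^sup>2 \<le> 1"
    and eps: "\<epsilon> * k \<le> m"
begin

abbreviation q :: real where "q \<equiv> m * k"

definition \<rho> :: real where "\<rho> = (1 - q) / (1 + q)"

text \<open>
  The weight of the tangential velocity is determined by \<open>K \<rho>\<^sup>2 = 1 - q\<close>. In the degenerate case
  \<open>q = 1\<close> both factors vanish, \<open>K\<close> because division by zero yields zero, and the identity persists.
\<close>
definition K :: real where "K = (1 + q)\<^sup>2 / (1 - q)"

definition energy :: "'a \<Rightarrow> 'a \<Rightarrow> real" where
  "energy x v = gap x + 1/2 * (norm (b *\<^sub>R (v - P v) + m *\<^sub>R offset (x + (b * k) *\<^sub>R v)))\<^sup>2
     + K / 2 * (norm (P v))\<^sup>2"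

lemma q_pos: "0 < q" using m k by simp

lemma q_le_1: "q \<le> 1"
proof -
  have "1 * q \<le> c * q" using c q_pos by (intro mult_right_mono) auto
  then show ?thesis using q_le by simp
qed

lemma rho_q: "\<rho> * (1 + q) = 1 - q" using q_pos by (simp add: \<rho>_def)

lemma K_nonneg: "0 \<le> K" using q_le_1 by (simp add: K_def)

lemma K_rho: "K * \<rho>\<^sup>2 = 1 - q"
  using q_pos by (cases "q = 1") (auto simp: K_def \<rho>_def power_divide power2_eq_square)

lemma energy_nonneg: "0 \<le> energy x v"
  using gap_nonneg K_nonneg by (simp add: energy_def)

lemma gap_le_energy: "gap x \<le> energy x v"
  using K_nonneg by (simp add: energy_def)

lemma energy_start: "energy x 0 = gap x + \<mu> / 2 * (norm (offset x))\<^sup>2"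
  using m by (simp add: energy_def power_mult_distrib linear_0[OF P_linear])

lemma norm_split: "(norm u)\<^sup>2 = (norm (P u))\<^sup>2 + (norm (u - P u))\<^sup>2"
  using inner_residual_V[OF P_in_V, of u u]
  by (simp add: power2_norm_eq_inner inner_diff_left inner_diff_right inner_commute)

lemma inner_split: "u \<bullet> w = P u \<bullet> P w + (u - P u) \<bullet> (w - P w)"
  using inner_residual_V[OF P_in_V, of u w] inner_residual_V[OF P_in_V, of w u]
  by (simp add: inner_diff_left inner_diff_right inner_commute)

text \<open>
  Here \<open>\<gamma>\<close> is any value of the stochastic gradient at the extrapolated point \<open>y\<close>. The bound is a
  quadratic polynomial in \<open>\<gamma>\<close>, so that only the first two moments of \<open>\<gamma>\<close> matter for its expectation.
  Half of the quadratic term comes from the descent lemma, half from the two kinetic terms.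
\<close>
lemma energy_step_le:
  fixes x v \<gamma> :: 'a
  defines "y \<equiv> x + (b * k) *\<^sub>R v"
  shows "energy (y - (c * k\<^sup>2) *\<^sub>R \<gamma>) (\<rho> *\<^sub>R (v - (b * k) *\<^sub>R \<gamma>))
    \<le> gap y + 1/2 * (norm (((1 - q) * b) *\<^sub>R (v - P v) + m *\<^sub>R offset y))\<^sup>2 + (1 - q) / 2 * (norm (P v))\<^sup>2
      - ((c * k\<^sup>2) *\<^sub>R grad y + ((1 - q) * b * k) *\<^sub>R v + q *\<^sub>R offset y) \<bullet> \<gamma> + k\<^sup>2 * (norm \<gamma>)\<^sup>2"
proof -
  define A where "A = ((1 - q) * b) *\<^sub>R (v - P v) + m *\<^sub>R offset y"
  define v' where "v' = \<rho> *\<^sub>R (v - (b * k) *\<^sub>R \<gamma>)"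
  define x' where "x' = y - (c * k\<^sup>2) *\<^sub>R \<gamma>"
  \<comment> \<open>The two relations between the parameters that make the transversal vector evolve simply.\<close>
  have coeff_v: "b * \<rho> + m * b * k * \<rho> = (1 - q) * b"
  proof -
    have "b * \<rho> + m * b * k * \<rho> = b * (\<rho> * (1 + q))" by (simp add: algebra_simps)
    then show ?thesis unfolding rho_q by simp
  qed
  have coeff_g: "(1 - q) * b * b * k + m * c * k\<^sup>2 = k"
  proof -
    have "(1 - q) * b * b * k + m * c * k\<^sup>2 = (b\<^sup>2 * (1 - q) + c * q) * k"
      by (simp add: algebra_simps power2_eq_square)
    also have "\<dots> = k" unfolding b_eq by simp
    finally show ?thesis .
  qed
  have z: "b *\<^sub>R (v' - P v') + m *\<^sub>R offset (x' + (b * k) *\<^sub>R v') = A - k *\<^sub>R (\<gamma> - P \<gamma>)"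
  proof -
    have "b *\<^sub>R (v' - P v') + m *\<^sub>R offset (x' + (b * k) *\<^sub>R v')
      = (b * \<rho> + m * b * k * \<rho>) *\<^sub>R (v - P v) + m *\<^sub>R offset y
        - ((b * \<rho> + m * b * k * \<rho>) * b * k + m * c * k\<^sup>2) *\<^sub>R (\<gamma> - P \<gamma>)"
      unfolding x'_def v'_def diff_conv_add_uminus offset_add
      by (simp add: P_simps linear_neg[OF P_linear] algebra_simps)
    also have "\<dots> = A - k *\<^sub>R (\<gamma> - P \<gamma>)"
      unfolding coeff_v coeff_g A_def ..
    finally show ?thesis .
  qed
  have perp: "(norm (A - k *\<^sub>R (\<gamma> - P \<gamma>)))\<^sup>2
      = (norm A)\<^sup>2 - 2 * ((1 - q) * b * k * ((v - P v) \<bullet> (\<gamma> - P \<gamma>)) + q * (offset y \<bullet> \<gamma>))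
        + k\<^sup>2 * (norm (\<gamma> - P \<gamma>))\<^sup>2"
  proof -
    define X where "X = (v - P v) \<bullet> (\<gamma> - P \<gamma>)"
    have A: "A \<bullet> (\<gamma> - P \<gamma>) = (1 - q) * b * X + m * (offset y \<bullet> \<gamma>)"
      using offset_orthogonal[of y \<gamma>]
      by (simp add: A_def X_def inner_add_left inner_diff_right right_diff_distrib)
    have split: "A - k *\<^sub>R (\<gamma> - P \<gamma>) = 1 *\<^sub>R A + (- k) *\<^sub>R (\<gamma> - P \<gamma>)" by simp
    show ?thesis
      unfolding split norm_scaled_sum_square A X_def[symmetric] by (simp add: algebra_simps)
  qed
  have par: "K * (norm (P v'))\<^sup>2 \<le> (1 - q) * (norm (P v))\<^sup>2
      - 2 * ((1 - q) * b * k * (P v \<bullet> P \<gamma>)) + k\<^sup>2 * (norm (P \<gamma>))\<^sup>2"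
  proof -
    have "K * (norm (P v'))\<^sup>2 = K * \<rho>\<^sup>2 * (norm (P v - (b * k) *\<^sub>R P \<gamma>))\<^sup>2"
      by (simp add: v'_def P_simps power_mult_distrib)
    also have "\<dots> = (1 - q) * (norm (P v))\<^sup>2 - 2 * ((1 - q) * b * k * (P v \<bullet> P \<gamma>))
        + (b\<^sup>2 * (1 - q)) * (k\<^sup>2 * (norm (P \<gamma>))\<^sup>2)"
      unfolding K_rho
      using norm_scaled_sum_square[of 1 "P v" "- (b * k)" "P \<gamma>"]
      by (simp add: power_mult_distrib) (simp add: algebra_simps)
    also have "(b\<^sup>2 * (1 - q)) * (k\<^sup>2 * (norm (P \<gamma>))\<^sup>2) \<le> 1 * (k\<^sup>2 * (norm (P \<gamma>))\<^sup>2)"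
      unfolding b_eq using q_pos c by (intro mult_right_mono) auto
    finally show ?thesis by simp
  qed
  have fdec: "gap x' \<le> gap y - (c * k\<^sup>2) * (grad y \<bullet> \<gamma>) + 1/2 * (k\<^sup>2 * (norm \<gamma>)\<^sup>2)"
  proof -
    have "f x' \<le> f y + grad y \<bullet> (- (c * k\<^sup>2) *\<^sub>R \<gamma>) + L / 2 * (norm (- (c * k\<^sup>2) *\<^sub>R \<gamma>))\<^sup>2"
      using descent_lemma[OF gradient lipschitz, of y "- (c * k\<^sup>2) *\<^sub>R \<gamma>"] by (simp add: x'_def)
    also have "L / 2 * (norm (- (c * k\<^sup>2) *\<^sub>R \<gamma>))\<^sup>2 = 1/2 * (L * (c * k)\<^sup>2) * (k\<^sup>2 * (norm \<gamma>)\<^sup>2)"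
      by (simp add: power_mult_distrib power2_eq_square)
    also have "\<dots> \<le> 1/2 * 1 * (k\<^sup>2 * (norm \<gamma>)\<^sup>2)"
      using step_le by (intro mult_right_mono mult_left_mono) auto
    finally show ?thesis by (simp add: gap_def)
  qed
  \<comment> \<open>Equal coefficients of the tangential and transversal products reassemble the full velocity.\<close>
  have cross: "((c * k\<^sup>2) *\<^sub>R grad y + ((1 - q) * b * k) *\<^sub>R v + q *\<^sub>R offset y) \<bullet> \<gamma>
     = (c * k\<^sup>2) * (grad y \<bullet> \<gamma>)
       + ((1 - q) * b * k * (P v \<bullet> P \<gamma>) + (1 - q) * b * k * ((v - P v) \<bullet> (\<gamma> - P \<gamma>)))
       + q * (offset y \<bullet> \<gamma>)"
    unfolding inner_add_left inner_scaleR_left inner_split[of v \<gamma>] by (simp only: distrib_left)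
  have add_up: "F1 + 1/2 * (N - 2 * (T + R) + k\<^sup>2 * G) + 1/2 * K1
      \<le> F0 + 1/2 * N + (1 - q) / 2 * N0 - (D + (S + T) + R) + k\<^sup>2 * (H + G)"
    if "F1 \<le> F0 - D + 1/2 * (k\<^sup>2 * (H + G))" "K1 \<le> (1 - q) * N0 - 2 * S + k\<^sup>2 * H"
    for F1 F0 N T R G K1 N0 D S H
    using that by (simp add: field_simps)
  have "energy x' v' = gap x' + 1/2 * (norm (A - k *\<^sub>R (\<gamma> - P \<gamma>)))\<^sup>2 + 1/2 * (K * (norm (P v'))\<^sup>2)"
    unfolding energy_def z by simp
  also have "\<dots> \<le> gap y + 1/2 * (norm A)\<^sup>2 + (1 - q) / 2 * (norm (P v))\<^sup>2
      - ((c * k\<^sup>2) *\<^sub>R grad y + ((1 - q) * b * k) *\<^sub>R v + q *\<^sub>R offset y) \<bullet> \<gamma> + k\<^sup>2 * (norm \<gamma>)\<^sup>2"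
    unfolding cross perp norm_split[of \<gamma>] by (rule add_up[OF fdec[unfolded norm_split[of \<gamma>]] par])
  finally show ?thesis unfolding A_def x'_def v'_def .
qed

text \<open>
  This is the bound of \<open>energy_step_le\<close> with \<open>\<gamma>\<close> replaced by the gradient, without the terms that
  the gradient step cancels. Almost convexity, weighted by \<open>1 - q\<close>, turns \<open>gap y\<close> into \<open>gap x\<close>, and
  strong convexity, weighted by \<open>q\<close>, turns the rest of \<open>gap y\<close> into a multiple of the squared offset.
  Compared with \<open>(1 - q) energy x v\<close>, the transversal kinetic energy is short by the amount
  \<open>(1 - q) q b\<^sup>2 |v - P v|\<^sup>2 / 2\<close>, which is what pays for the defect \<open>\<epsilon>\<close> of convexity.
\<close>
lemma energy_contraction:
  fixes x v :: 'a
  defines "y \<equiv> x + (b * k) *\<^sub>R v"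
  shows "gap y + 1/2 * (norm (((1 - q) * b) *\<^sub>R (v - P v) + m *\<^sub>R offset y))\<^sup>2 + (1 - q) / 2 * (norm (P v))\<^sup>2
      - (((1 - q) * b * k) *\<^sub>R v + q *\<^sub>R offset y) \<bullet> grad y
    \<le> (1 - q) * energy x v"
proof -
  define X Y Z where "X = (norm (v - P v))\<^sup>2" and "Y = (norm (P v))\<^sup>2" and "Z = (v - P v) \<bullet> offset y"
  have XY: "0 \<le> X" "0 \<le> Y" by (simp_all add: X_def Y_def)
  have conv: "(1 - q) * (b * k * (v \<bullet> grad y)) \<ge> (1 - q) * (gap y - gap x - \<epsilon> / 2 * ((b * k)\<^sup>2 * (X + Y)))"
    using almost_convexity[of x "(b * k) *\<^sub>R v"] norm_split[of v] q_le_1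
    by (intro mult_left_mono)
       (auto simp: y_def gap_def X_def Y_def inner_commute power_mult_distrib add.commute)
  have star: "q * (offset y \<bullet> grad y) \<ge> q * (gap y + m\<^sup>2 / 2 * (norm (offset y))\<^sup>2)"
    using strong_convexity_gap[of y] q_pos m by (intro mult_left_mono) (auto simp: inner_commute)
  have sq: "(norm (r *\<^sub>R (v - P v) + m *\<^sub>R offset y))\<^sup>2
      = r\<^sup>2 * X + 2 * (r * m * Z) + m\<^sup>2 * (norm (offset y))\<^sup>2" for r
    unfolding norm_scaled_sum_square X_def Z_def ..
  have epsk: "\<epsilon> * (b * k)\<^sup>2 \<le> q * b\<^sup>2"
  proof -
    have "\<epsilon> * (b * k)\<^sup>2 = (\<epsilon> * k) * (k * b\<^sup>2)" by (simp add: power2_eq_square)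
    also have "\<dots> \<le> m * (k * b\<^sup>2)" using eps k by (intro mult_right_mono) auto
    finally show ?thesis by simp
  qed
  have perp: "(1 - q) * ((\<epsilon> * (b * k)\<^sup>2) * X) \<le> (1 - q) * ((q * b\<^sup>2) * X)"
    using epsk XY q_le_1 by (intro mult_left_mono mult_right_mono) auto
  \<comment> \<open>Along \<open>V\<close> the weight \<open>K\<close>, at least \<open>1 / (1 - q)\<close>, leaves enough room for the defect.\<close>
  have par: "(1 - q) * Y + (1 - q) * ((\<epsilon> * (b * k)\<^sup>2) * Y) \<le> (1 - q) * (K * Y)"
  proof (cases "q = 1")
    case False
    then have q1: "q < 1" using q_le_1 by simp
    have "(1 - q) * (\<epsilon> * (b * k)\<^sup>2) \<le> (1 - q) * (q * b\<^sup>2)"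
      using epsk q1 by (intro mult_left_mono) auto
    also have "\<dots> = q * (1 - c * q)" using b_eq by (metis mult.assoc mult.commute)
    also have "\<dots> \<le> q * 1" using c q_pos by (intro mult_left_mono) auto
    finally have "(1 - q) + (1 - q) * (\<epsilon> * (b * k)\<^sup>2) \<le> 1" by simp
    also have "\<dots> \<le> (1 + q)\<^sup>2" using q_pos by simp
    also have "\<dots> = (1 - q) * K" using q1 by (simp add: K_def)
    finally have "((1 - q) + (1 - q) * (\<epsilon> * (b * k)\<^sup>2)) * Y \<le> ((1 - q) * K) * Y"
      using XY by (intro mult_right_mono) auto
    then show ?thesis by (simp only: distrib_right mult.assoc)
  qed simp
  have gain: "A + B + 1/2 * (C - C') + 1/2 * D \<le> A + B + 1/2 * D'"
    if "C \<le> C'" "D \<le> D'" for A B C C' D D' :: real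
    using that by argo
  have "gap y + 1/2 * (norm (((1 - q) * b) *\<^sub>R (v - P v) + m *\<^sub>R offset y))\<^sup>2 + (1 - q) / 2 * Y
      - (((1 - q) * b * k) *\<^sub>R v + q *\<^sub>R offset y) \<bullet> grad y
    = gap y + 1/2 * (((1 - q) * b)\<^sup>2 * X + 2 * ((1 - q) * b * m * Z) + m\<^sup>2 * (norm (offset y))\<^sup>2)
      + (1 - q) / 2 * Y - (1 - q) * (b * k * (v \<bullet> grad y)) - q * (offset y \<bullet> grad y)"
    unfolding sq by (simp add: inner_add_left ac_simps)
  also have "\<dots> \<le> gap y + 1/2 * (((1 - q) * b)\<^sup>2 * X + 2 * ((1 - q) * b * m * Z) + m\<^sup>2 * (norm (offset y))\<^sup>2)
      + (1 - q) / 2 * Y - (1 - q) * (gap y - gap x - \<epsilon> / 2 * ((b * k)\<^sup>2 * (X + Y)))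
      - q * (gap y + m\<^sup>2 / 2 * (norm (offset y))\<^sup>2)"
    using conv star by linarith
  also have "\<dots> = (1 - q) * gap x
      + 1/2 * ((1 - q) * (b\<^sup>2 * X + 2 * (b * m * Z) + m\<^sup>2 * (norm (offset y))\<^sup>2))
      + 1/2 * ((1 - q) * ((\<epsilon> * (b * k)\<^sup>2) * X) - (1 - q) * ((q * b\<^sup>2) * X))
      + 1/2 * ((1 - q) * Y + (1 - q) * ((\<epsilon> * (b * k)\<^sup>2) * Y))"
    by (simp add: field_simps power2_eq_square)
  also have "\<dots> \<le> (1 - q) * gap x
      + 1/2 * ((1 - q) * (b\<^sup>2 * X + 2 * (b * m * Z) + m\<^sup>2 * (norm (offset y))\<^sup>2))
      + 1/2 * ((1 - q) * (K * Y))"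
    by (rule gain[OF perp par])
  also have "\<dots> = (1 - q) * energy x v"
    unfolding energy_def y_def[symmetric] sq Y_def[symmetric] by (simp add: field_simps)
  finally show ?thesis unfolding Y_def .
qed

end

section \<open>Independence of the past and fresh noise\<close>

lemma (in prob_space) distr_Pair_eq_pair_measure:
  assumes X: "X \<in> measurable M S" and Y: "Y \<in> measurable M T"
    and indep: "\<And>A B. A \<in> sets S \<Longrightarrow> B \<in> sets T \<Longrightarrow>
      prob ((X -` A \<inter> space M) \<inter> (Y -` B \<inter> space M))
      = prob (X -` A \<inter> space M) * prob (Y -` B \<inter> space M)"
  shows "distr M (S \<Otimes>\<^sub>M T) (\<lambda>s. (X s, Y s)) = distr M S X \<Otimes>\<^sub>M distr M T Y"
proof (rule pair_measure_eqI[symmetric])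
  interpret X: prob_space "distr M S X" by (rule prob_space_distr[OF X])
  interpret Y: prob_space "distr M T Y" by (rule prob_space_distr[OF Y])
  show "sigma_finite_measure (distr M S X)" "sigma_finite_measure (distr M T Y)"
    by unfold_locales
  fix A B assume "A \<in> sets (distr M S X)" "B \<in> sets (distr M T Y)"
  then have AB: "A \<in> sets S" "B \<in> sets T" by simp_all
  have "(\<lambda>s. (X s, Y s)) -` (A \<times> B) \<inter> space M = (X -` A \<inter> space M) \<inter> (Y -` B \<inter> space M)"
    by auto
  then show "emeasure (distr M S X) A * emeasure (distr M T Y) B
    = emeasure (distr M (S \<Otimes>\<^sub>M T) (\<lambda>s. (X s, Y s))) (A \<times> B)"
    using AB X Y indep[OF AB]
    by (simp add: emeasure_distr emeasure_eq_measure ennreal_mult[symmetric])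
qed simp

text \<open>
  The \<open>\<sigma>\<close>-algebra generated by the initial value and the first \<open>n\<close> noise variables, as a measure space
  on the points of \<open>N\<close> so that the notions of measurability apply to it.
\<close>
definition past ::
  "'s measure \<Rightarrow> 'a measure \<Rightarrow> ('s \<Rightarrow> 'a) \<Rightarrow> 'w measure \<Rightarrow> (nat \<Rightarrow> 's \<Rightarrow> 'w) \<Rightarrow> nat \<Rightarrow> 's measure"
  where "past N A X Q \<omega> n = sigma (space N)
    ({X -` B \<inter> space N | B. B \<in> sets A} \<union> (\<Union>i<n. {\<omega> i -` B \<inter> space N | B. B \<in> sets Q}))"

lemma space_past [simp]: "space (past N A X Q \<omega> n) = space N"
  by (simp add: past_def space_measure_of_conv)

lemma sets_past:
  "sets (past N A X Q \<omega> n) = sigma_sets (space N)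
    ({X -` B \<inter> space N | B. B \<in> sets A} \<union> (\<Union>i<n. {\<omega> i -` B \<inter> space N | B. B \<in> sets Q}))"
  unfolding past_def by (rule sets_measure_of) auto

lemma measurable_past_mono:
  assumes "m \<le> n" and "Z \<in> measurable (past N A X Q \<omega> m) S"
  shows "Z \<in> measurable (past N A X Q \<omega> n) S"
proof -
  have "sets (past N A X Q \<omega> m) \<subseteq> sets (past N A X Q \<omega> n)"
    unfolding sets_past 
    by (intro sigma_sets_mono' Un_mono UN_mono) (use assms(1) in auto)
  then show ?thesis using assms(2) by (auto simp: measurable_def)
qed

lemma initial_measurable_past:
  assumes "X \<in> measurable N A"
  shows "X \<in> measurable (past N A X Q \<omega> n) A"
  using assms by (intro measurableI) (auto simp: sets_past intro!: sigma_sets.Basic dest: measurable_space)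

lemma noise_measurable_past:
  assumes "\<omega> i \<in> measurable N Q" and "i < n"
  shows "\<omega> i \<in> measurable (past N A X Q \<omega> n) Q"
  using assms by (intro measurableI) (auto simp: sets_past intro!: sigma_sets.Basic dest: measurable_space)

lemma subalgebra_past:
  assumes X: "X \<in> measurable N A" and om: "\<And>i. \<omega> i \<in> measurable N Q"
  shows "subalgebra N (past N A X Q \<omega> n)"
  unfolding subalgebra_def sets_past
  using measurable_sets[OF X] measurable_sets[OF om]
  by (auto intro!: sets.sigma_sets_subset)

text \<open>
  Grouping the generators into those with index before \<open>n\<close> and the one with index \<open>n\<close> makes the past
  independent of \<open>\<omega> n\<close>. Hence the joint law of \<open>Z\<close> and \<open>\<omega> n\<close> is a product, and integrating over it
  is integrating over the noise first, with the past held fixed.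
\<close>
lemma nn_integral_fresh_noise:
  fixes n :: nat
  assumes N: "prob_space N"
    and indep: "indep_initial_noise N A X Q \<omega>"
    and Z: "Z \<in> measurable (past N A X Q \<omega> n) S"
    and h: "h \<in> borel_measurable (S \<Otimes>\<^sub>M Q)"
  shows "(\<integral>\<^sup>+s. h (Z s, \<omega> n s) \<partial>N) = (\<integral>\<^sup>+s. (\<integral>\<^sup>+w. h (Z s, w) \<partial>distr N Q (\<omega> n)) \<partial>N)"
proof -
  interpret N: prob_space N by (rule N)
  define E where "E = case_option {X -` B \<inter> space N | B. B \<in> sets A}
                    (\<lambda>i. {\<omega> i -` B \<inter> space N | B. B \<in> sets Q})"
  \<comment> \<open>\<open>True\<close> collects the indices of the past, with \<open>None\<close> for the initial value.\<close>
  define I where "I = (\<lambda>j. if j then insert None (Some ` {..<n}) else {Some n})"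
  have X: "X \<in> measurable N A" and E: "N.indep_sets E UNIV"
    using indep by (auto simp: indep_initial_noise_def E_def)
  have om: "\<omega> i \<in> measurable N Q" for i
    using indep by (auto simp: indep_initial_noise_def)
  have Int_stable_vimage: "Int_stable {f -` B \<inter> space N | B. B \<in> sets T}"
    for f :: "'a \<Rightarrow> 't" and T
  proof (rule Int_stableI, clarsimp)
    fix B B' assume "B \<in> sets T" "B' \<in> sets T"
    then show "\<exists>C. f -` B \<inter> space N \<inter> (f -` B' \<inter> space N) = f -` C \<inter> space N \<and> C \<in> sets T"
      by (intro exI[of _ "B \<inter> B'"]) auto
  qed
  have "N.indep_sets (\<lambda>j. sigma_sets (space N) (\<Union>i\<in>I j. E i)) UNIV"
  proof (rule N.indep_sets_collect_sigma)
    show "N.indep_sets E (\<Union>j\<in>UNIV. I j)"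
      using E by (rule N.indep_sets_mono_index[rotated]) simp
    show "Int_stable (E i)" for i
      by (cases i) (auto simp: E_def intro: Int_stable_vimage)
    show "disjoint_family_on I UNIV" by (auto simp: disjoint_family_on_def I_def)
  qed
  then have ind: "a \<in> sigma_sets (space N) (\<Union>i\<in>I True. E i) \<Longrightarrow>
      b \<in> sigma_sets (space N) (\<Union>i\<in>I False. E i) \<Longrightarrow>
      N.prob (a \<inter> b) = N.prob a * N.prob b" for a b
    using N.indep_setsD[of _ UNIV UNIV "\<lambda>j. if j then a else b"]
    by (simp add: UNIV_bool Int_commute mult.commute)
  have sub: "subalgebra N (past N A X Q \<omega> n)"
    by (rule subalgebra_past[OF X om])
  have ZN: "Z \<in> measurable N S" by (rule measurable_from_subalg[OF sub Z])
  have joint: "distr N (S \<Otimes>\<^sub>M Q) (\<lambda>s. (Z s, \<omega> n s)) = distr N S Z \<Otimes>\<^sub>M distr N Q (\<omega> n)"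
  proof (rule N.distr_Pair_eq_pair_measure[OF ZN om], rule ind)
    fix C B assume C: "C \<in> sets S" and B: "B \<in> sets Q"
    show "Z -` C \<inter> space N \<in> sigma_sets (space N) (\<Union>i\<in>I True. E i)"
      using measurable_sets[OF Z C] by (simp add: sets_past I_def E_def)
    show "\<omega> n -` B \<inter> space N \<in> sigma_sets (space N) (\<Union>i\<in>I False. E i)"
      using B by (auto simp: I_def E_def)
  qed
  interpret D: prob_space "distr N Q (\<omega> n)" by (rule N.prob_space_distr[OF om])
  have [measurable]: "Z \<in> measurable N S" "\<omega> n \<in> measurable N Q" by (fact ZN om)+
  have hD: "h \<in> borel_measurable (M \<Otimes>\<^sub>M distr N Q (\<omega> n))" if "sets M = sets S" for M
    using h by (subst measurable_cong_sets[OF sets_pair_measure_cong[OF that sets_distr] refl])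
  have "(\<integral>\<^sup>+s. h (Z s, \<omega> n s) \<partial>N) = integral\<^sup>N (distr N (S \<Otimes>\<^sub>M Q) (\<lambda>s. (Z s, \<omega> n s))) h"
    using h by (intro nn_integral_distr[symmetric]) measurable
  also have "\<dots> = (\<integral>\<^sup>+z. (\<integral>\<^sup>+w. h (z, w) \<partial>distr N Q (\<omega> n)) \<partial>distr N S Z)"
    unfolding joint by (intro D.nn_integral_fst[symmetric] hD) simp
  also have "\<dots> = (\<integral>\<^sup>+s. (\<integral>\<^sup>+w. h (Z s, w) \<partial>distr N Q (\<omega> n)) \<partial>N)"
    by (intro nn_integral_distr ZN D.borel_measurable_nn_integral_fst hD sets_distr refl)
  finally show ?thesis .
qed

section \<open>Expected decay of the energy\<close>

lemma (in prob_space) second_moment_of_variance: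
  fixes X :: "'a \<Rightarrow> 'b::euclidean_space"
  assumes X: "X \<in> borel_measurable M" and sq: "integrable M (\<lambda>w. (norm (X w))\<^sup>2)"
  shows "integrable M X"
    and "expectation (\<lambda>w. (norm (X w))\<^sup>2)
      = expectation (\<lambda>w. (norm (X w - expectation X))\<^sup>2) + (norm (expectation X))\<^sup>2"
proof -
  show int: "integrable M X"
  proof (rule Bochner_Integration.integrable_bound[OF _ X])
    show "integrable M (\<lambda>w. 1 + (norm (X w))\<^sup>2)" using sq by simp
    have "norm z \<le> norm (1 + (norm z)\<^sup>2)" for z :: 'b
    proof -
      have "0 \<le> (norm z - 1)\<^sup>2 + (norm z)\<^sup>2 + 1" by simp
      then show ?thesis by (simp add: power2_diff)
    qed
    then show "AE w in M. norm (X w) \<le> norm (1 + (norm (X w))\<^sup>2)" by simp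
  qed
  define m where "m = expectation X"
  have "(\<lambda>w. (norm (X w - m))\<^sup>2) = (\<lambda>w. (norm (X w))\<^sup>2 - 2 * (X w \<bullet> m) + (norm m)\<^sup>2)"
    by (simp add: power2_norm_eq_inner inner_diff_left inner_diff_right inner_commute algebra_simps)
  then have "expectation (\<lambda>w. (norm (X w - m))\<^sup>2)
    = expectation (\<lambda>w. (norm (X w))\<^sup>2) - 2 * (m \<bullet> m) + (norm m)\<^sup>2"
    using int sq by (simp add: prob_space m_def)
  then show "expectation (\<lambda>w. (norm (X w))\<^sup>2)
      = expectation (\<lambda>w. (norm (X w - expectation X))\<^sup>2) + (norm (expectation X))\<^sup>2"
    by (simp add: m_def power2_norm_eq_inner)
qed

locale agnes_noise = agnes_energy f grad V P xstar L \<mu> \<epsilon> m k c b + Q: prob_space Q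
  for f :: "'a::euclidean_space \<Rightarrow> real" and grad V P xstar L \<mu> \<epsilon> m k c b
    and Q :: "'w measure" +
  fixes g :: "'a \<Rightarrow> 'w \<Rightarrow> 'a" and \<sigma>\<^sub>a :: real
  assumes g_measurable: "(\<lambda>(y, w). g y w) \<in> borel_measurable (borel \<Otimes>\<^sub>M Q)"
    and g_unbiased: "\<And>y. (\<integral>w. g y w \<partial>Q) = grad y"
    and g_second_moment: "\<And>y. integrable Q (\<lambda>w. (norm (g y w))\<^sup>2)"
    and g_variance: "\<And>y. (\<integral>w. (norm (g y w - grad y))\<^sup>2 \<partial>Q)
      \<le> \<sigma>\<^sub>a\<^sup>2 + (c - 1) * (norm (grad y))\<^sup>2"
begin

lemma g_compose [measurable (raw)]:
  assumes "y \<in> borel_measurable M" and "w \<in> measurable M Q"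
  shows "(\<lambda>s. g (y s) (w s)) \<in> borel_measurable M"
  using measurable_compose[OF measurable_Pair[OF assms] g_measurable] by simp

lemma P_borel [measurable]: "P \<in> borel_measurable borel"
  using P_linear
  by (intro borel_measurable_continuous_onI linear_continuous_on)
     (simp add: linear_conv_bounded_linear)

lemma energy_measurable [measurable (raw)]:
  assumes [measurable]: "x \<in> borel_measurable M" "v \<in> borel_measurable M"
  shows "(\<lambda>s. energy (x s) (v s)) \<in> borel_measurable M"
proof -
  note gap_measurable [measurable]
  show ?thesis unfolding energy_def offset_def by measurable
qed

text \<open>
  Since the second moment of the stochastic gradient is at most \<open>\<sigma>\<^sub>a\<^sup>2 + c |grad y|\<^sup>2\<close>, the
  quadratic term of \<open>energy_step_le\<close> contributes \<open>c k\<^sup>2 |grad y|\<^sup>2\<close>, which the linear term cancels,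
  and the noise floor \<open>k\<^sup>2 \<sigma>\<^sub>a\<^sup>2\<close>.
\<close>
lemma expected_energy_step:
  fixes x v :: 'a
  defines "y \<equiv> x + (b * k) *\<^sub>R v"
  shows "(\<integral>\<^sup>+w. ennreal (energy (y - (c * k\<^sup>2) *\<^sub>R g y w) (\<rho> *\<^sub>R (v - (b * k) *\<^sub>R g y w))) \<partial>Q)
    \<le> ennreal ((1 - q) * energy x v + k\<^sup>2 * \<sigma>\<^sub>a\<^sup>2)"
proof -
  define B where "B = gap y + 1/2 * (norm (((1 - q) * b) *\<^sub>R (v - P v) + m *\<^sub>R offset y))\<^sup>2
    + (1 - q) / 2 * (norm (P v))\<^sup>2"
  define C where "C = (c * k\<^sup>2) *\<^sub>R grad y + ((1 - q) * b * k) *\<^sub>R v + q *\<^sub>R offset y"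
  have gy: "g y \<in> borel_measurable Q" by measurable
  have int: "integrable Q (g y)"
    and second: "(\<integral>w. (norm (g y w))\<^sup>2 \<partial>Q)
      = (\<integral>w. (norm (g y w - grad y))\<^sup>2 \<partial>Q) + (norm (grad y))\<^sup>2"
    using Q.second_moment_of_variance[OF gy g_second_moment] by (simp_all add: g_unbiased)
  have le: "energy (y - (c * k\<^sup>2) *\<^sub>R g y w) (\<rho> *\<^sub>R (v - (b * k) *\<^sub>R g y w))
      \<le> B - C \<bullet> g y w + k\<^sup>2 * (norm (g y w))\<^sup>2" for w
    using energy_step_le[of x v "g y w"] unfolding B_def C_def y_def by simp
  have "(\<integral>\<^sup>+w. ennreal (energy (y - (c * k\<^sup>2) *\<^sub>R g y w) (\<rho> *\<^sub>R (v - (b * k) *\<^sub>R g y w))) \<partial>Q)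
    \<le> (\<integral>\<^sup>+w. ennreal (B - C \<bullet> g y w + k\<^sup>2 * (norm (g y w))\<^sup>2) \<partial>Q)"
    by (intro nn_integral_mono ennreal_leI le)
  also have "\<dots> = ennreal (\<integral>w. B - C \<bullet> g y w + k\<^sup>2 * (norm (g y w))\<^sup>2 \<partial>Q)"
    using int g_second_moment[of y] order_trans[OF energy_nonneg le]
    by (intro nn_integral_eq_integral) auto
  also have "(\<integral>w. B - C \<bullet> g y w + k\<^sup>2 * (norm (g y w))\<^sup>2 \<partial>Q)
      = B - C \<bullet> grad y + k\<^sup>2 * (\<integral>w. (norm (g y w))\<^sup>2 \<partial>Q)"
    using int g_second_moment[of y] by (simp add: Q.prob_space g_unbiased)
  also have "ennreal \<dots> \<le> ennreal ((1 - q) * energy x v + k\<^sup>2 * \<sigma>\<^sub>a\<^sup>2)"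
  proof (rule ennreal_leI)
    have "k\<^sup>2 * (\<integral>w. (norm (g y w))\<^sup>2 \<partial>Q) \<le> k\<^sup>2 * (\<sigma>\<^sub>a\<^sup>2 + c * (norm (grad y))\<^sup>2)"
      unfolding second using g_variance[of y] by (intro mult_left_mono) (auto simp: left_diff_distrib)
    moreover have "C \<bullet> grad y
        = c * k\<^sup>2 * (norm (grad y))\<^sup>2 + (((1 - q) * b * k) *\<^sub>R v + q *\<^sub>R offset y) \<bullet> grad y"
      by (simp add: C_def inner_add_left power2_norm_eq_inner)
    ultimately show "B - C \<bullet> grad y + k\<^sup>2 * (\<integral>w. (norm (g y w))\<^sup>2 \<partial>Q)
        \<le> (1 - q) * energy x v + k\<^sup>2 * \<sigma>\<^sub>a\<^sup>2"
      using energy_contraction[where x = x and v = v] unfolding B_def y_def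
      by (simp add: distrib_left mult.left_commute)
  qed
  finally show ?thesis .
qed

text \<open>
  The state at time \<open>n\<close> has been built from the noise of the steps before \<open>n\<close> only.
\<close>
lemma iterates_measurable_past:
  assumes indep: "indep_initial_noise N borel (x 0) Q \<omega>"
    and agnes: "\<And>s. s \<in> space N \<Longrightarrow>
      agnes_scheme g \<eta> \<rho>' \<alpha> (\<lambda>k. \<omega> k s) (\<lambda>k. x k s) (\<lambda>k. x' k s) (\<lambda>k. v k s)"
  shows "x n \<in> borel_measurable (past N borel (x 0) Q \<omega> n)
    \<and> v n \<in> borel_measurable (past N borel (x 0) Q \<omega> n)"
proof (induction n)
  case 0
  have "v 0 s = 0" if "s \<in> space N" for s
    using agnes[OF that] by (simp add: agnes_scheme_def)
  then have "v 0 \<in> borel_measurable (past N borel (x 0) Q \<omega> 0) \<longleftrightarrow>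
      (\<lambda>s. 0 :: 'a) \<in> borel_measurable (past N borel (x 0) Q \<omega> 0)"
    by (intro measurable_cong) simp
  moreover have "x 0 \<in> borel_measurable (past N borel (x 0) Q \<omega> 0)"
    using indep by (intro initial_measurable_past) (simp add: indep_initial_noise_def)
  ultimately show ?case by simp
next
  case (Suc n)
  let ?H = "past N borel (x 0) Q \<omega> (Suc n)"
  have [measurable]: "x n \<in> borel_measurable ?H" "v n \<in> borel_measurable ?H"
    using Suc measurable_past_mono[of n "Suc n"] by auto
  have [measurable]: "\<omega> n \<in> measurable ?H Q"
    using indep by (intro noise_measurable_past) (auto simp: indep_initial_noise_def)
  have step: "x (Suc n) s = x n s + sqrt \<alpha> *\<^sub>R v n s - \<eta> *\<^sub>R g (x n s + sqrt \<alpha> *\<^sub>R v n s) (\<omega> n s)"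
    "v (Suc n) s = \<rho>' *\<^sub>R (v n s - sqrt \<alpha> *\<^sub>R g (x n s + sqrt \<alpha> *\<^sub>R v n s) (\<omega> n s))"
    if "s \<in> space ?H" for s
    using agnes[of s] that by (simp_all add: agnes_scheme_def)
  show ?case
  proof
    show "x (Suc n) \<in> borel_measurable ?H"
      by (subst measurable_cong[OF step(1)], assumption) measurable
    show "v (Suc n) \<in> borel_measurable ?H"
      by (subst measurable_cong[OF step(2)], assumption) measurable
  qed
qed

text \<open>
  The additive constant is the fixed point of \<open>t \<mapsto> (1 - q) t + k\<^sup>2 \<sigma>\<^sub>a\<^sup>2\<close>, namely
  \<open>k\<^sup>2 \<sigma>\<^sub>a\<^sup>2 / q\<close> with \<open>q = m k\<close>, and therefore reproduces itself in the induction.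
\<close>
lemma expected_energy_decay:
  assumes N: "prob_space N"
    and law: "\<And>i. distr N Q (\<omega> i) = Q"
    and indep: "indep_initial_noise N borel (x 0) Q \<omega>"
    and agnes: "\<And>s. s \<in> space N \<Longrightarrow>
      agnes_scheme g (c * k\<^sup>2) \<rho> ((b * k)\<^sup>2) (\<lambda>k. \<omega> k s) (\<lambda>k. x k s) (\<lambda>k. x' k s) (\<lambda>k. v k s)"
  shows "(\<integral>\<^sup>+s. ennreal (energy (x n s) (v n s)) \<partial>N)
    \<le> ennreal ((1 - q) ^ n) * (\<integral>\<^sup>+s. ennreal (energy (x 0 s) (v 0 s)) \<partial>N)
      + ennreal (\<sigma>\<^sub>a\<^sup>2 * k / m)"
proof (induction n)
  case 0
  show ?case by simp
next
  case (Suc n)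
  interpret N: prob_space N by (rule N)
  let ?H = "past N borel (x 0) Q \<omega> n"
  let ?E0 = "\<integral>\<^sup>+s. ennreal (energy (x 0 s) (v 0 s)) \<partial>N"
  define h where "h = (\<lambda>((x, v), w). ennreal (energy
    (x + (b * k) *\<^sub>R v - (c * k\<^sup>2) *\<^sub>R g (x + (b * k) *\<^sub>R v) w)
    (\<rho> *\<^sub>R (v - (b * k) *\<^sub>R g (x + (b * k) *\<^sub>R v) w))))"
  have h: "h \<in> borel_measurable ((borel \<Otimes>\<^sub>M borel) \<Otimes>\<^sub>M Q)"
    unfolding h_def case_prod_beta by measurable
  have xv: "x n \<in> borel_measurable ?H" "v n \<in> borel_measurable ?H"
    using iterates_measurable_past[OF indep agnes] by auto
  have sub: "subalgebra N ?H"
    using indep by (intro subalgebra_past) (auto simp: indep_initial_noise_def)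
  have [measurable]: "x n \<in> borel_measurable N" "v n \<in> borel_measurable N"
    using measurable_from_subalg[OF sub] xv by auto
  have bk: "sqrt ((b * k)\<^sup>2) = b * k" using b k by simp
  have "(\<integral>\<^sup>+s. ennreal (energy (x (Suc n) s) (v (Suc n) s)) \<partial>N)
      = (\<integral>\<^sup>+s. h ((x n s, v n s), \<omega> n s) \<partial>N)"
    using agnes unfolding h_def agnes_scheme_def bk
    by (intro nn_integral_cong) simp
  also have "\<dots> = (\<integral>\<^sup>+s. (\<integral>\<^sup>+w. h ((x n s, v n s), w) \<partial>Q) \<partial>N)"
    using nn_integral_fresh_noise[OF N indep _ h, of "\<lambda>s. (x n s, v n s)" n] xv
    by (simp add: law)
  also have "\<dots> \<le> (\<integral>\<^sup>+s. ennreal ((1 - q) * energy (x n s) (v n s) + k\<^sup>2 * \<sigma>\<^sub>a\<^sup>2) \<partial>N)"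
    unfolding h_def prod.case by (intro nn_integral_mono expected_energy_step)
  also have "\<dots> = (\<integral>\<^sup>+s. ennreal (1 - q) * ennreal (energy (x n s) (v n s))
      + ennreal (k\<^sup>2 * \<sigma>\<^sub>a\<^sup>2) \<partial>N)"
    using q_le_1 energy_nonneg by (simp add: ennreal_plus ennreal_mult)
  also have "\<dots> = ennreal (1 - q) * (\<integral>\<^sup>+s. ennreal (energy (x n s) (v n s)) \<partial>N)
      + ennreal (k\<^sup>2 * \<sigma>\<^sub>a\<^sup>2)"
    by (simp add: nn_integral_add nn_integral_cmult N.emeasure_space_1)
  also have "\<dots> \<le> ennreal (1 - q) * (ennreal ((1 - q) ^ n) * ?E0 + ennreal (\<sigma>\<^sub>a\<^sup>2 * k / m))
      + ennreal (k\<^sup>2 * \<sigma>\<^sub>a\<^sup>2)"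
    by (intro add_right_mono mult_left_mono Suc.IH) simp
  also have "\<dots> = ennreal ((1 - q) ^ Suc n) * ?E0
      + (ennreal ((1 - q) * (\<sigma>\<^sub>a\<^sup>2 * k / m)) + ennreal (k\<^sup>2 * \<sigma>\<^sub>a\<^sup>2))"
  proof -
    have "ennreal ((1 - q) * (\<sigma>\<^sub>a\<^sup>2 * k / m)) = ennreal (1 - q) * ennreal (\<sigma>\<^sub>a\<^sup>2 * k / m)"
      and "ennreal ((1 - q) ^ Suc n) = ennreal (1 - q) * ennreal ((1 - q) ^ n)"
      using q_le_1 k m by (simp_all add: ennreal_mult[symmetric])
    then show ?thesis by (simp only: distrib_left mult.assoc add.assoc)
  qed
  also have "ennreal ((1 - q) * (\<sigma>\<^sub>a\<^sup>2 * k / m)) + ennreal (k\<^sup>2 * \<sigma>\<^sub>a\<^sup>2) = ennreal (\<sigma>\<^sub>a\<^sup>2 * k / m)"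
  proof -
    have "(1 - q) * (\<sigma>\<^sub>a\<^sup>2 * k / m) + k\<^sup>2 * \<sigma>\<^sub>a\<^sup>2 = \<sigma>\<^sub>a\<^sup>2 * k / m"
      using m by (simp add: field_simps power2_eq_square)
    moreover have "0 \<le> (1 - q) * (\<sigma>\<^sub>a\<^sup>2 * k / m)" using q_le_1 k m by simp
    ultimately show ?thesis by (simp flip: ennreal_plus)
  qed
  finally show ?case .
qed

end

section \<open>Convergence of the scheme\<close>

theorem theorem15:
  fixes f :: "real ^ 'd \<Rightarrow> real"
    and grad :: "real ^ 'd \<Rightarrow> real ^ 'd"
    and V :: "(real ^ 'd) set"
    and P \<pi> :: "real ^ 'd \<Rightarrow> real ^ 'd"
    and xstar :: "real ^ 'd"
    and L \<mu> \<epsilon> \<sigma>\<^sub>a \<sigma>\<^sub>m \<eta> \<rho> \<alpha> :: real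
    and Q :: "'w measure"
    and g :: "real ^ 'd \<Rightarrow> 'w \<Rightarrow> real ^ 'd"
    and N :: "'s measure"
    and \<omega> :: "nat \<Rightarrow> 's \<Rightarrow> 'w"
    and x x' v :: "nat \<Rightarrow> 's \<Rightarrow> real ^ 'd"
    and n :: nat
  assumes gradient: "\<And>y. GDERIV f y :> grad y"
    and C1: "continuous_on UNIV grad"
    and L_pos: "L > 0"
    and lipschitz: "L-lipschitz_on UNIV grad"
    and bounded_below: "bdd_below (range f)"
    and mu_pos: "\<mu> > 0"
    and V_subspace: "subspace V"
    and V_dim: "dim V < CARD('d)"
    and P_proj: "orthogonal_projection_onto V P"
    and minimizers_affine: "minimizers f = {xstar + u | u. u \<in> V}"
    and xstar_min_norm: "\<forall>y \<in> {xstar + u | u. u \<in> V}. norm xstar \<le> norm y"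
    and closest: "\<pi> = closest_point (minimizers f)"
    and closest_affine: "\<And>y. \<pi> y = P y + xstar"
    and strong_convexity_min:
      "\<And>y. grad y \<bullet> (y - \<pi> y) \<ge> f y - f (\<pi> y) + \<mu> / 2 * (norm (y - \<pi> y))\<^sup>2"
    and almost_convexity:
      "\<And>y u. grad (y + u) \<bullet> u \<ge> f (y + u) - f y - \<epsilon> / 2 * (norm u)\<^sup>2"
    and Q_prob: "prob_space Q"
    and g_measurable: "(\<lambda>(y, w). g y w) \<in> borel_measurable (borel \<Otimes>\<^sub>M Q)"
    and sigma_nonneg: "\<sigma>\<^sub>a \<ge> 0" "\<sigma>\<^sub>m \<ge> 0"
    and g_unbiased: "\<And>y. (\<integral>w. g y w \<partial>Q) = grad y"
    and g_second_moment: "\<And>y. integrable Q (\<lambda>w. (norm (g y w))\<^sup>2)"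
    and g_variance:
      "\<And>y. (\<integral>w. (norm (g y w - grad y))\<^sup>2 \<partial>Q) \<le> \<sigma>\<^sub>a\<^sup>2 + \<sigma>\<^sub>m\<^sup>2 * (norm (grad y))\<^sup>2"
    and eta: "0 < \<eta>" "\<eta> \<le> 1 / (L * (1 + \<sigma>\<^sub>m\<^sup>2))"
    and rho: "\<rho> = (1 - sqrt (\<mu> * \<eta> / (1 + \<sigma>\<^sub>m\<^sup>2))) / (1 + sqrt (\<mu> * \<eta> / (1 + \<sigma>\<^sub>m\<^sup>2)))"
    and alpha: "\<alpha> = (1 - sqrt (\<mu> * (1 + \<sigma>\<^sub>m\<^sup>2) * \<eta>)) / (1 - sqrt (\<mu> * (1 + \<sigma>\<^sub>m\<^sup>2) * \<eta>) + \<sigma>\<^sub>m\<^sup>2) * \<eta>"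
    and N_prob: "prob_space N"
    and omega_law: "\<And>i. distr N Q (\<omega> i) = Q"
    and independent: "indep_initial_noise N borel (x 0) Q \<omega>"
    and agnes: "\<And>s. s \<in> space N \<Longrightarrow>
      agnes_scheme g \<eta> \<rho> \<alpha> (\<lambda>k. \<omega> k s) (\<lambda>k. x k s) (\<lambda>k. x' k s) (\<lambda>k. v k s)"
    and eps: "\<epsilon> < sqrt (\<mu> * (1 + \<sigma>\<^sub>m\<^sup>2) / \<eta>)"
  shows "(\<integral>\<^sup>+ s. ennreal (f (x n s) - (INF z. f z)) \<partial>N)
       \<le> ennreal ((1 - sqrt (\<mu> * \<eta> / (1 + \<sigma>\<^sub>m\<^sup>2))) ^ n)
           * (\<integral>\<^sup>+ s. ennreal (f (x 0 s) - (INF z. f z)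
                              + \<mu> / 2 * (norm (x 0 s - \<pi> (x 0 s)))\<^sup>2) \<partial>N)
         + ennreal (\<sigma>\<^sub>a\<^sup>2 * sqrt \<eta> / sqrt (\<mu> * (1 + \<sigma>\<^sub>m\<^sup>2)))"
proof -
  interpret Q: prob_space Q by (rule Q_prob)
  define c where "c = 1 + \<sigma>\<^sub>m\<^sup>2"
  define k where "k = sqrt (\<eta> / c)"
  define m where "m = sqrt \<mu>"
  define q where "q = m * k"
  define b where "b = sqrt ((1 - c * q) / (1 - q))"
  have c: "1 \<le> c" by (simp add: c_def)
  have k: "k > 0" "c * k\<^sup>2 = \<eta>" using eta(1) c by (simp_all add: k_def)
  have m: "m > 0" "m\<^sup>2 = \<mu>" using mu_pos by (simp_all add: m_def)
  have q: "q > 0" "sqrt (\<mu> * \<eta> / (1 + \<sigma>\<^sub>m\<^sup>2)) = q"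
    by (use m(1) k(1) in \<open>simp add: q_def\<close>)
      (simp add: q_def m_def k_def c_def real_sqrt_mult[symmetric])
  have cq_sq: "(c * q)\<^sup>2 = \<mu> * c * \<eta>"
    unfolding m(2)[symmetric] k(2)[symmetric] q_def by (simp add: power2_eq_square)
  then have cq: "sqrt (\<mu> * (1 + \<sigma>\<^sub>m\<^sup>2) * \<eta>) = c * q"
    using c q unfolding c_def[symmetric] by (intro real_sqrt_unique) auto
  have Lc: "L * c * \<eta> \<le> 1"
    using eta(2) L_pos c unfolding c_def[symmetric] by (simp add: field_simps)
  interpret G: affine_minimizers f grad V P xstar L \<mu>
  proof
    show "norm xstar \<le> norm (xstar + u)" if "u \<in> V" for u
      using xstar_min_norm that by blast
    show "grad y \<bullet> (y - (P y + xstar))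
        \<ge> f y - f (P y + xstar) + \<mu> / 2 * (norm (y - (P y + xstar)))\<^sup>2" for y
      using strong_convexity_min[of y] by (simp add: closest_affine)
  qed (fact gradient L_pos lipschitz bounded_below mu_pos V_subspace P_proj minimizers_affine)+
  have "V \<noteq> UNIV" using V_dim by auto
  then have "\<mu> \<le> L" by (rule G.mu_le_L)
  then have "\<mu> * c * \<eta> \<le> L * c * \<eta>" using c eta(1) by (intro mult_right_mono) auto
  then have "(c * q)\<^sup>2 \<le> 1\<^sup>2" unfolding cq_sq using Lc by simp
  then have q_le: "c * q \<le> 1" by (rule power2_le_imp_le) simp
  have q1: "q \<le> 1"
  proof -
    have "1 * q \<le> c * q" using c q(1) by (intro mult_right_mono) auto
    then show ?thesis using q_le by simp
  qed
  have b_sq: "b\<^sup>2 = (1 - c * q) / (1 - q)" using q_le q1 by (simp add: b_def)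
  \<comment> \<open>If \<open>q = 1\<close>, then \<open>c q \<le> 1\<close> leaves only \<open>c = 1\<close>, and both sides vanish.\<close>
  have b_eq: "b\<^sup>2 * (1 - q) = 1 - c * q"
    using b_sq c q_le by (cases "q = 1") auto
  \<comment> \<open>This includes \<open>q = 1\<close>, where both \<open>\<alpha>\<close> and \<open>b\<close> are quotients by zero, hence zero.\<close>
  have alpha_eq: "\<alpha> = (b * k)\<^sup>2"
  proof -
    have "1 - c * q + \<sigma>\<^sub>m\<^sup>2 = c * (1 - q)" by (simp add: c_def algebra_simps)
    then have "\<alpha> = (1 - c * q) / (c * (1 - q)) * (c * k\<^sup>2)"
      unfolding alpha cq k(2) by simp
    then show ?thesis using c by (simp add: power_mult_distrib b_sq)
  qed
  have "sqrt (\<mu> * (1 + \<sigma>\<^sub>m\<^sup>2) / \<eta>) = m / k"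
    by (simp add: m_def k_def c_def real_sqrt_mult real_sqrt_divide)
  then have "\<epsilon> < m / k" using eps by simp
  then have eps_k: "\<epsilon> * k \<le> m" using k(1) by (simp add: field_simps)
  interpret A: agnes_noise f grad V P xstar L \<mu> \<epsilon> m k c b Q g \<sigma>\<^sub>a
  proof
    show "b\<^sup>2 * (1 - m * k) = 1 - c * (m * k)" "c * (m * k) \<le> 1"
      using b_eq q_le by (simp_all add: q_def)
    show "L * (c * k)\<^sup>2 \<le> 1"
      using Lc unfolding k(2)[symmetric] by (simp add: power2_eq_square mult.left_commute mult.commute)
    show "0 \<le> b" using q_le q1 by (simp add: b_def)
    show "(\<integral>w. (norm (g y w - grad y))\<^sup>2 \<partial>Q) \<le> \<sigma>\<^sub>a\<^sup>2 + (c - 1) * (norm (grad y))\<^sup>2" for y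
      using g_variance[of y] by (simp add: c_def)
  qed (fact almost_convexity m k(1) c eps_k g_measurable g_unbiased g_second_moment)+
  have rho_eq: "\<rho> = A.\<rho>" unfolding A.\<rho>_def rho q(2) q_def ..
  have scheme: "agnes_scheme g (c * k\<^sup>2) A.\<rho> ((b * k)\<^sup>2)
      (\<lambda>k. \<omega> k s) (\<lambda>k. x k s) (\<lambda>k. x' k s) (\<lambda>k. v k s)" if "s \<in> space N" for s
    using agnes[OF that] unfolding alpha_eq rho_eq k(2) .
  have start: "A.energy (x 0 s) (v 0 s)
      = f (x 0 s) - (INF z. f z) + \<mu> / 2 * (norm (x 0 s - \<pi> (x 0 s)))\<^sup>2" if "s \<in> space N" for s
    using scheme[OF that] A.energy_start[of "x 0 s"]
    by (simp add: agnes_scheme_def G.gap_def G.offset_def closest_affine)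
  have noise_eq: "\<sigma>\<^sub>a\<^sup>2 * k / m = \<sigma>\<^sub>a\<^sup>2 * sqrt \<eta> / sqrt (\<mu> * (1 + \<sigma>\<^sub>m\<^sup>2))"
    by (simp add: k_def m_def c_def real_sqrt_mult real_sqrt_divide mult.commute)
  have "(\<integral>\<^sup>+ s. ennreal (f (x n s) - (INF z. f z)) \<partial>N)
      \<le> (\<integral>\<^sup>+ s. ennreal (A.energy (x n s) (v n s)) \<partial>N)"
    using A.gap_le_energy by (intro nn_integral_mono ennreal_leI) (simp add: G.gap_def)
  also have "\<dots> \<le> ennreal ((1 - m * k) ^ n) * (\<integral>\<^sup>+ s. ennreal (A.energy (x 0 s) (v 0 s)) \<partial>N)
      + ennreal (\<sigma>\<^sub>a\<^sup>2 * k / m)"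
    by (rule A.expected_energy_decay[OF N_prob omega_law independent scheme])
  also have "(\<integral>\<^sup>+ s. ennreal (A.energy (x 0 s) (v 0 s)) \<partial>N)
      = (\<integral>\<^sup>+ s. ennreal (f (x 0 s) - (INF z. f z)
                              + \<mu> / 2 * (norm (x 0 s - \<pi> (x 0 s)))\<^sup>2) \<partial>N)"
    using start by (intro nn_integral_cong) simp
  finally show ?thesis unfolding q(2) noise_eq q_def .
qed

end
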